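(* Let $(\varepsilon,\lessdot)$ be a prioritized Extended Bundle Event Structure with $\varepsilon=(E,\leadsto,\mapsto,l)$, and let $\lessdot'=\lessdot\setminus\{(e,e')\mid e'\leadsto e\vee(\exists X\subseteq E.\ (e\in X\wedge X\mapsto e')\vee(e'\in X\wedge X\mapsto e))\}$. Then $\mathrm{Traces}(\varepsilon,\lessdot)=\mathrm{Traces}(\varepsilon,\lessdot')$.
   Context: An Extended Bundle Event Structure (EBES) is a quadruple $\varepsilon=(E,\leadsto,\mapsto,l)$ where $E$ is a set of events, $\leadsto\subseteq E\times E$ is an irreflexive relation (disabling; $e\leadsto e'$ means that once $e'$ has occurred, $e$ can no longer occur), $\mapsto\subseteq\mathcal{P}(E)\times E$ is the enabling relation (a pair $(X,e)$ is written $X\mapsto e$), and $l:E\to Act$ is a labeling function, satisfying Stability: whenever $X\mapsto e$, any two distinct $e_1,e_2\in X$ satisfy $e_1\leadsto e_2$. For a finite sequence $\sigma=e_1\cdots e_n$ write $\bar\sigma=\{e_1,\dots,e_n\}$, $\sigma_i=e_1\cdots e_i$ ($\sigma_0$ empty), and $\mathrm{en}_\varepsilon(\sigma)=\{e\in E\setminus\bar\sigma\mid(\forall X\subseteq E.\ X\mapsto e\Rightarrow X\cap\bar\sigma\neq\emptyset)\wedge\neg\exists e'\in\bar\sigma.\ e\leadsto e'\}$. $\sigma$ is a trace of $\varepsilon$ iff $e_i\in\mathrm{en}_\varepsilon(\sigma_{i-1})$ for all $1\le i\le n$. A prioritized EBES (PEBES) is a pair $(\varepsilon,\lessdot)$ with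 $\lessdot\subseteq E\times E$ acyclic ($e\lessdot e'$: $e'$ has higher priority). $\sigma=e_1\cdots e_n$ is a trace of $(\varepsilon,\lessdot)$ iff $\sigma$ is a trace of $\varepsilon$ and for all $0\le i<n$ and all $e_j,e_h\in\bar\sigma$ with $e_j\neq e_h$, $e_j,e_h\in\mathrm{en}_\varepsilon(\sigma_i)$ and $e_h\lessdot e_j$, we have $j<h$; $\mathrm{Traces}(\varepsilon,\lessdot)$ is the set of these traces (same for subrelations of $\lessdot$). *)

theory Defs
  imports Main
begin

(* The type variable 'act is the set Act of actions.  The labelling is a total function on the
   type of events; only its values on the event set are meaningful.
   (e, e') \<in> disabling: once e' has occurred, e can no longer occur.
   (X, e) \<in> enabling: X is a bundle for e. *)
record ('e, 'act) ebes =
  events :: "'e set"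
  disabling :: "('e \<times> 'e) set"
  enabling :: "('e set \<times> 'e) set"
  label :: "'e \<Rightarrow> 'act"

definition is_ebes :: "('e, 'act) ebes \<Rightarrow> bool" where
  "is_ebes \<epsilon> \<longleftrightarrow>
     disabling \<epsilon> \<subseteq> events \<epsilon> \<times> events \<epsilon> \<and> irrefl (disabling \<epsilon>) \<and>
     enabling \<epsilon> \<subseteq> Pow (events \<epsilon>) \<times> events \<epsilon> \<and>
     (\<forall>X e. (X, e) \<in> enabling \<epsilon> \<longrightarrow>
        (\<forall>e1\<in>X. \<forall>e2\<in>X. e1 \<noteq> e2 \<longrightarrow> (e1, e2) \<in> disabling \<epsilon>))"

definition en :: "('e, 'act) ebes \<Rightarrow> 'e list \<Rightarrow> 'e set" where
  "en \<epsilon> \<sigma> = {e \<in> events \<epsilon> - set \<sigma>.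
     (\<forall>X\<subseteq>events \<epsilon>. (X, e) \<in> enabling \<epsilon> \<longrightarrow> X \<inter> set \<sigma> \<noteq> {}) \<and>
     \<not> (\<exists>e'\<in>set \<sigma>. (e, e') \<in> disabling \<epsilon>)}"

(* Lists are indexed from 0, so the event at position i is the one that follows the prefix
   of length i. *)
definition is_trace :: "('e, 'act) ebes \<Rightarrow> 'e list \<Rightarrow> bool" where
  "is_trace \<epsilon> \<sigma> \<longleftrightarrow> (\<forall>i<length \<sigma>. \<sigma> ! i \<in> en \<epsilon> (take i \<sigma>))"

(* (e, e') \<in> P: e' has higher priority than e. *)
definition is_pebes :: "('e, 'act) ebes \<Rightarrow> ('e \<times> 'e) set \<Rightarrow> bool" where
  "is_pebes \<epsilon> P \<longleftrightarrow> is_ebes \<epsilon> \<and> P \<subseteq> events \<epsilon> \<times> events \<epsilon> \<and> acyclic P"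

definition Traces :: "('e, 'act) ebes \<Rightarrow> ('e \<times> 'e) set \<Rightarrow> 'e list set" where
  "Traces \<epsilon> P = {\<sigma>. is_trace \<epsilon> \<sigma> \<and>
     (\<forall>i<length \<sigma>. \<forall>j<length \<sigma>. \<forall>h<length \<sigma>.
        \<sigma> ! j \<noteq> \<sigma> ! h \<and> \<sigma> ! j \<in> en \<epsilon> (take i \<sigma>) \<and> \<sigma> ! h \<in> en \<epsilon> (take i \<sigma>) \<and>
        (\<sigma> ! h, \<sigma> ! j) \<in> P \<longrightarrow> j < h)}"

end

theory Submission
  imports Defs
begin

text \<open>
  Removing pairs from the priority relation can only add traces, so it suffices to see that the
  removed pairs impose no constraint. If \<open>e'\<close> is disabled by \<open>e\<close>, then \<open>e'\<close> precedes \<open>e\<close> in every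
  trace containing both. If one of the two lies in a bundle of the other, then by stability they
  are never enabled simultaneously.
\<close>

text \<open>Since \<open>e'\<close> is enabled, some \<open>x \<in> X\<close> has already occurred.
  Either \<open>e\<close> is this \<open>x\<close>, or stability makes \<open>x\<close> disable
  \<open>e\<close>; in both cases \<open>e\<close> can no longer occur.\<close>

lemma bundle_member_not_en:
  assumes "is_ebes \<epsilon>" and "(X, e') \<in> enabling \<epsilon>" and "e \<in> X" and "e' \<in> en \<epsilon> \<sigma>"
  shows "e \<notin> en \<epsilon> \<sigma>"
proof
  assume e: "e \<in> en \<epsilon> \<sigma>"
  have "X \<subseteq> events \<epsilon>"
    using assms(1,2) unfolding is_ebes_def by blast
  then obtain x where x: "x \<in> X" "x \<in> set \<sigma>"
    using assms(2,4) unfolding en_def by blast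
  then have "e \<noteq> x"
    using e unfolding en_def by blast
  then have "(e, x) \<in> disabling \<epsilon>"
    using assms(1-3) x(1) unfolding is_ebes_def by blast
  then show False
    using e x(2) unfolding en_def by blast
qed

text \<open>If \<open>h < j\<close>, the prefix of length \<open>j\<close> contains
  \<open>\<sigma> ! h\<close>, which keeps \<open>\<sigma> ! j\<close> from being enabled
  there.\<close>

lemma trace_disabling_order:
  assumes "is_trace \<epsilon> \<sigma>" and "j < length \<sigma>" and "(\<sigma> ! j, \<sigma> ! h) \<in> disabling \<epsilon>"
  shows "j \<le> h"
proof (rule ccontr)
  assume "\<not> j \<le> h"
  then have "\<sigma> ! h \<in> set (take j \<sigma>)"
    using assms(2) by (auto simp: in_set_conv_nth intro!: exI[of _ h])
  then show False
    using assms unfolding is_trace_def en_def by blast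
qed

theorem theorem6:
  fixes \<epsilon> :: "('e, 'act) ebes" and P P' :: "('e \<times> 'e) set"
  assumes "is_pebes \<epsilon> P"
    and "P' = P - {(e, e'). (e', e) \<in> disabling \<epsilon> \<or>
           (\<exists>X\<subseteq>events \<epsilon>. (e \<in> X \<and> (X, e') \<in> enabling \<epsilon>) \<or> (e' \<in> X \<and> (X, e) \<in> enabling \<epsilon>))}"
  shows "Traces \<epsilon> P = Traces \<epsilon> P'"
proof
  show "Traces \<epsilon> P \<subseteq> Traces \<epsilon> P'"
    unfolding Traces_def assms(2) by blast
next
  have ebes: "is_ebes \<epsilon>"
    using assms(1) unfolding is_pebes_def by blast
  show "Traces \<epsilon> P' \<subseteq> Traces \<epsilon> P"
  proof
    fix \<sigma> assume \<sigma>: "\<sigma> \<in> Traces \<epsilon> P'"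
    then have trace: "is_trace \<epsilon> \<sigma>"
      unfolding Traces_def by blast
    have "j < h"
      if len: "i < length \<sigma>" "j < length \<sigma>" "h < length \<sigma>" and ne: "\<sigma> ! j \<noteq> \<sigma> ! h"
        and en: "\<sigma> ! j \<in> en \<epsilon> (take i \<sigma>)" "\<sigma> ! h \<in> en \<epsilon> (take i \<sigma>)"
        and P: "(\<sigma> ! h, \<sigma> ! j) \<in> P" for i j h
    proof (cases "(\<sigma> ! h, \<sigma> ! j) \<in> P'")
      case True
      then show ?thesis
        using \<sigma> len ne en unfolding Traces_def by blast
    next
      case False
      \<comment> \<open>The pair was removed from \<open>P\<close>. Both events are enabled after
        the same prefix, which excludes the two bundle alternatives, so disabling is the only reason
        left.\<close>
      then have "(\<sigma> ! j, \<sigma> ! h) \<in> disabling \<epsilon>"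
        using P en bundle_member_not_en[OF ebes] unfolding assms(2) by blast
      then have "j \<le> h"
        by (rule trace_disabling_order[OF trace len(2)])
      then show ?thesis
        using ne by (cases "j = h") auto
    qed
    then show "\<sigma> \<in> Traces \<epsilon> P"
      using trace unfolding Traces_def by blast
  qed
qed

end
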